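(* Let $P$ be a prepoloid with unique local units, and let $P[\mathsf{m}]$ be the set $P$ equipped with the restricted partial binary operation $\mathsf{m}:(x,y)\mapsto x\cdot y$, where $x\cdot y$ is defined if and only if $\rho_x=\lambda_y$, in which case $x\cdot y=xy$. Then $P[\mathsf{m}]$ is a poloid.
   Context: A magmoid is a non-empty set $P$ with a non-empty partial binary operation $(x,y)\mapsto xy$. A compound product such as $(xy)z$ is defined iff $xy$ is defined and the product of $xy$ with $z$ is defined (similarly for $x(yz)$). An asserted equation between products includes the assertion that both sides are defined. A semigroupoid is a magmoid $P$ such that for all $x,y,z\in P$: if $x(yz)$ is defined, or if $(xy)z$ is defined, or if both $xy$ and $yz$ are defined, then $x(yz)=(xy)z$ (both sides defined). A local left unit for $x\in P$ is some $\lambda_x\in P$ with $\lambda_x x=x$ (product defined); a local right unit for $x$ is some $\rho_x\in P$ with $x\rho_x=x$ (product defined). A prepoloid is a semigroupoid in which every element has a local left unit and a local right unit. It has unique local units if every $x\in P$ has exactly one local left unit, denoted $\lambda_x$, and exactly one local right unit, denoted $\rho_x$. (In a prepoloid, $\rho_x=\lambda_y$ implies that $xy$ is defined, so the restricted operation is well defined.) A two-sided unit in a magmoid $Q$ is some $e\in Q$ such that for every $y\in Q$: if $ey$ is defined then $ey=y$, and if $ye$ is defined then $ye=y$. A left (resp. right) effective unit for $x$ is a two-sided unit $\ell_x$ (resp. $r_x$) such that $\ell_x x$ is defined and equals $x$ (resp. $xr_x$ is defined and equals $x$). A poloid is a semigroupoid in which every element has a left effective unit and a right effective unit. *)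

theory Defs
  imports Main
begin

text \<open>
  A partial binary operation on a set \<open>P\<close> is a function \<open>m :: 'a \<Rightarrow> 'a \<Rightarrow> 'a option\<close>:
  \<open>m x y = None\<close> means that the product of \<open>x\<close> and \<open>y\<close> is undefined. Products are defined
  only for arguments in \<open>P\<close> and have their values in \<open>P\<close>.
\<close>

locale magmoid =
  fixes P :: "'a set" and m :: "'a \<Rightarrow> 'a \<Rightarrow> 'a option"
  assumes carrier_nonempty: "P \<noteq> {}"
    and operation_on: "m x y = Some z \<Longrightarrow> x \<in> P \<and> y \<in> P \<and> z \<in> P"
    and operation_nonempty: "\<exists>x\<in>P. \<exists>y\<in>P. m x y \<noteq> None"

text \<open>The compound products \<open>(xy)z\<close> and \<open>x(yz)\<close>.\<close>

definition prod_left :: "('a \<Rightarrow> 'a \<Rightarrow> 'a option) \<Rightarrow> 'a \<Rightarrow> 'a \<Rightarrow> 'a \<Rightarrow> 'a option"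
  where "prod_left m x y z = Option.bind (m x y) (\<lambda>u. m u z)"

definition prod_right :: "('a \<Rightarrow> 'a \<Rightarrow> 'a option) \<Rightarrow> 'a \<Rightarrow> 'a \<Rightarrow> 'a \<Rightarrow> 'a option"
  where "prod_right m x y z = Option.bind (m y z) (\<lambda>v. m x v)"

text \<open>
  The conjunct \<open>prod_right m x y z \<noteq> None\<close> is needed because an equation between products
  asserts that both sides are defined, whereas \<open>None = None\<close> holds in HOL.
\<close>

locale semigroupoid = magmoid +
  assumes assoc:
    "\<lbrakk>x \<in> P; y \<in> P; z \<in> P;
      prod_right m x y z \<noteq> None \<or> prod_left m x y z \<noteq> None \<or> (m x y \<noteq> None \<and> m y z \<noteq> None)\<rbrakk>
     \<Longrightarrow> prod_right m x y z \<noteq> None \<and> prod_right m x y z = prod_left m x y z"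

definition local_left_unit :: "'a set \<Rightarrow> ('a \<Rightarrow> 'a \<Rightarrow> 'a option) \<Rightarrow> 'a \<Rightarrow> 'a \<Rightarrow> bool"
  where "local_left_unit P m x l \<longleftrightarrow> l \<in> P \<and> m l x = Some x"

definition local_right_unit :: "'a set \<Rightarrow> ('a \<Rightarrow> 'a \<Rightarrow> 'a option) \<Rightarrow> 'a \<Rightarrow> 'a \<Rightarrow> bool"
  where "local_right_unit P m x r \<longleftrightarrow> r \<in> P \<and> m x r = Some x"

locale prepoloid = semigroupoid +
  assumes ex_local_left_unit: "x \<in> P \<Longrightarrow> \<exists>l. local_left_unit P m x l"
    and ex_local_right_unit: "x \<in> P \<Longrightarrow> \<exists>r. local_right_unit P m x r"

definition unique_local_units :: "'a set \<Rightarrow> ('a \<Rightarrow> 'a \<Rightarrow> 'a option) \<Rightarrow> bool"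
  where "unique_local_units P m \<longleftrightarrow>
    (\<forall>x\<in>P. (\<exists>!l. local_left_unit P m x l) \<and> (\<exists>!r. local_right_unit P m x r))"

text \<open>\<open>\<lambda>\<^sub>x\<close> and \<open>\<rho>\<^sub>x\<close>; meaningful for \<open>x \<in> P\<close> when local units are unique.\<close>

definition the_left_unit :: "'a set \<Rightarrow> ('a \<Rightarrow> 'a \<Rightarrow> 'a option) \<Rightarrow> 'a \<Rightarrow> 'a"
  where "the_left_unit P m x = (THE l. local_left_unit P m x l)"

definition the_right_unit :: "'a set \<Rightarrow> ('a \<Rightarrow> 'a \<Rightarrow> 'a option) \<Rightarrow> 'a \<Rightarrow> 'a"
  where "the_right_unit P m x = (THE r. local_right_unit P m x r)"

definition restricted_op :: "'a set \<Rightarrow> ('a \<Rightarrow> 'a \<Rightarrow> 'a option) \<Rightarrow> 'a \<Rightarrow> 'a \<Rightarrow> 'a option"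
  where "restricted_op P m x y =
    (if x \<in> P \<and> y \<in> P \<and> the_right_unit P m x = the_left_unit P m y then m x y else None)"

text \<open>
  In the case of interest \<open>m x y\<close> is defined whenever \<open>\<rho>\<^sub>x = \<lambda>\<^sub>y\<close>, so the restricted product
  is defined exactly when \<open>\<rho>\<^sub>x = \<lambda>\<^sub>y\<close>.
\<close>

lemma restricted_op_defined_iff:
  assumes "prepoloid P m" and "unique_local_units P m" and "x \<in> P" and "y \<in> P"
  shows "restricted_op P m x y \<noteq> None \<longleftrightarrow> the_right_unit P m x = the_left_unit P m y"
proof
  assume eq: "the_right_unit P m x = the_left_unit P m y"
  interpret prepoloid P m by fact
  define e where "e = the_left_unit P m y"
  have "local_left_unit P m y (the_left_unit P m y)"
    unfolding the_left_unit_def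
    by (rule theI'[where P = "local_left_unit P m y"])
      (use assms in \<open>simp add: unique_local_units_def\<close>)
  then have e: "e \<in> P" "m e y = Some y"
    by (auto simp: e_def local_left_unit_def)
  have "local_right_unit P m x (the_right_unit P m x)"
    unfolding the_right_unit_def
    by (rule theI'[where P = "local_right_unit P m x"])
      (use assms in \<open>simp add: unique_local_units_def\<close>)
  then have "m x e = Some x"
    by (simp add: e_def eq local_right_unit_def)
  with assoc[OF assms(3) e(1) assms(4)] e have "m x y \<noteq> None"
    by (simp add: prod_left_def prod_right_def)
  with eq assms(3,4) show "restricted_op P m x y \<noteq> None"
    by (simp add: restricted_op_def)
qed (auto simp: restricted_op_def split: if_splits)

definition two_sided_unit :: "'a set \<Rightarrow> ('a \<Rightarrow> 'a \<Rightarrow> 'a option) \<Rightarrow> 'a \<Rightarrow> bool"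
  where "two_sided_unit P m e \<longleftrightarrow> e \<in> P \<and>
    (\<forall>y\<in>P. (m e y \<noteq> None \<longrightarrow> m e y = Some y) \<and> (m y e \<noteq> None \<longrightarrow> m y e = Some y))"

definition left_effective_unit :: "'a set \<Rightarrow> ('a \<Rightarrow> 'a \<Rightarrow> 'a option) \<Rightarrow> 'a \<Rightarrow> 'a \<Rightarrow> bool"
  where "left_effective_unit P m x l \<longleftrightarrow> two_sided_unit P m l \<and> m l x = Some x"

definition right_effective_unit :: "'a set \<Rightarrow> ('a \<Rightarrow> 'a \<Rightarrow> 'a option) \<Rightarrow> 'a \<Rightarrow> 'a \<Rightarrow> bool"
  where "right_effective_unit P m x r \<longleftrightarrow> two_sided_unit P m r \<and> m x r = Some x"

locale poloid = semigroupoid +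
  assumes ex_left_effective_unit: "x \<in> P \<Longrightarrow> \<exists>l. left_effective_unit P m x l"
    and ex_right_effective_unit: "x \<in> P \<Longrightarrow> \<exists>r. right_effective_unit P m x r"

end

theory Submission
  imports Defs
begin

text \<open>
  In a product \<open>xy\<close> the left unit is that of \<open>x\<close> and the right unit that of \<open>y\<close>, and a local unit
  is its own left and right unit. Hence \<open>x \<cdot> (y \<cdot> z)\<close> and \<open>(x \<cdot> y) \<cdot> z\<close> are both defined exactly
  when \<open>\<rho>\<^sub>x = \<lambda>\<^sub>y\<close> and \<open>\<rho>\<^sub>y = \<lambda>\<^sub>z\<close>, and if \<open>e\<close> is a local unit with \<open>e \<cdot> y\<close> defined, then
  \<open>e = \<rho>\<^sub>e = \<lambda>\<^sub>y\<close>, so that \<open>e\<close> acts as a unit.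
\<close>

locale unique_prepoloid = prepoloid +
  assumes unique_units: "unique_local_units P m"
begin

abbreviation L :: "'a \<Rightarrow> 'a" where "L \<equiv> the_left_unit P m"
abbreviation R :: "'a \<Rightarrow> 'a" where "R \<equiv> the_right_unit P m"
abbreviation rop :: "'a \<Rightarrow> 'a \<Rightarrow> 'a option" where "rop \<equiv> restricted_op P m"

lemma left_unit:
  assumes "x \<in> P"
  shows "L x \<in> P" and "m (L x) x = Some x"
proof -
  have "local_left_unit P m x (L x)"
    unfolding the_left_unit_def
    by (rule theI'[where P = "local_left_unit P m x"])
      (use assms unique_units in \<open>simp add: unique_local_units_def\<close>)
  then show "L x \<in> P" and "m (L x) x = Some x"
    by (simp_all add: local_left_unit_def)
qed

lemma right_unit:
  assumes "x \<in> P"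
  shows "R x \<in> P" and "m x (R x) = Some x"
proof -
  have "local_right_unit P m x (R x)"
    unfolding the_right_unit_def
    by (rule theI'[where P = "local_right_unit P m x"])
      (use assms unique_units in \<open>simp add: unique_local_units_def\<close>)
  then show "R x \<in> P" and "m x (R x) = Some x"
    by (simp_all add: local_right_unit_def)
qed

lemma left_unit_eqI:
  assumes "m l x = Some x"
  shows "L x = l"
proof -
  have "x \<in> P" "local_left_unit P m x l"
    using operation_on[OF assms] assms by (auto simp: local_left_unit_def)
  with unique_units show ?thesis
    unfolding the_left_unit_def unique_local_units_def by (metis the1_equality)
qed

lemma right_unit_eqI:
  assumes "m x r = Some x"
  shows "R x = r"
proof -
  have "x \<in> P" "local_right_unit P m x r"
    using operation_on[OF assms] assms by (auto simp: local_right_unit_def)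
  with unique_units show ?thesis
    unfolding the_right_unit_def unique_local_units_def by (metis the1_equality)
qed

text \<open>This is the case of \<open>assoc\<close> in which both inner products are defined. The
  second conclusion is kept because the equation alone could be \<open>None = None\<close>.\<close>

lemma assoc_of_factors:
  assumes "m x y = Some u" and "m y z = Some v"
  shows "m x v = m u z" and "m u z \<noteq> None"
proof -
  have "prod_left m x y z = m u z" "prod_right m x y z = m x v"
    using assms by (simp_all add: prod_left_def prod_right_def)
  moreover have "prod_right m x y z \<noteq> None \<and> prod_right m x y z = prod_left m x y z"
    using operation_on[OF assms(1)] operation_on[OF assms(2)] assms by (intro assoc) simp_all
  ultimately show "m x v = m u z" and "m u z \<noteq> None"
    by metis+
qed

text \<open>Since \<open>(L x)(xy) = ((L x)x)y = xy\<close>, the element \<open>L x\<close> is a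
  left unit of the product, and uniqueness does the rest.\<close>

lemma left_unit_prod:
  assumes "m x y = Some u"
  shows "L u = L x"
proof (rule left_unit_eqI)
  have "m (L x) x = Some x"
    using operation_on[OF assms] by (simp add: left_unit)
  from assoc_of_factors(1)[OF this assms] assms show "m (L x) u = Some u"
    by simp
qed

lemma right_unit_prod:
  assumes "m x y = Some u"
  shows "R u = R y"
proof (rule right_unit_eqI)
  have "m y (R y) = Some y"
    using operation_on[OF assms] by (simp add: right_unit)
  from assoc_of_factors(1)[OF assms this] assms show "m u (R y) = Some u"
    by simp
qed

text \<open>Reassociating \<open>(L x)((L x)x) = x\<close> shows that \<open>(L x)(L x)\<close> is
  defined and is again a left unit of \<open>x\<close>, hence equals \<open>L x\<close> by
  uniqueness.\<close>

lemma left_unit_idem: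
  assumes "x \<in> P"
  shows "m (L x) (L x) = Some (L x)"
proof -
  have "prod_right m (L x) (L x) x = Some x"
    using assms by (simp add: prod_right_def left_unit)
  then have "prod_left m (L x) (L x) x = Some x"
    using assoc[of "L x" "L x" x] assms by (simp add: left_unit)
  then obtain u where "m (L x) (L x) = Some u" "m u x = Some x"
    by (auto simp: prod_left_def bind_eq_Some_conv)
  then show ?thesis
    by (simp add: left_unit_eqI)
qed

lemma right_unit_idem:
  assumes "x \<in> P"
  shows "m (R x) (R x) = Some (R x)"
proof -
  have "prod_left m x (R x) (R x) = Some x"
    using assms by (simp add: prod_left_def right_unit)
  then have "prod_right m x (R x) (R x) = Some x"
    using assoc[of x "R x" "R x"] assms by (simp add: right_unit)
  then obtain u where "m (R x) (R x) = Some u" "m x u = Some x"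
    by (auto simp: prod_right_def bind_eq_Some_conv)
  then show ?thesis
    by (simp add: right_unit_eqI)
qed

lemma rop_eq_Some_iff: "rop x y = Some u \<longleftrightarrow> R x = L y \<and> m x y = Some u"
  using operation_on by (auto simp: restricted_op_def)

text \<open>With \<open>e\<close> the common unit, \<open>xe = x\<close> and \<open>ey = y\<close>
  are both defined, so associativity makes \<open>(xe)y = xy\<close> defined.\<close>

lemma rop_defined:
  assumes "x \<in> P" "y \<in> P" "R x = L y"
  obtains u where "m x y = Some u" "rop x y = Some u"
proof -
  have "rop x y \<noteq> None"
    using restricted_op_defined_iff[OF prepoloid_axioms unique_units] assms by simp
  then obtain u where "rop x y = Some u"
    by blast
  with that show thesis
    by (simp add: rop_eq_Some_iff)
qed

text \<open>The matching condition is \<open>R (L x) = L x\<close>, which idempotence of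
  \<open>L x\<close> supplies.\<close>

lemma rop_left_unit:
  assumes "x \<in> P"
  shows "rop (L x) x = Some x"
  using assms by (simp add: rop_eq_Some_iff left_unit right_unit_eqI[OF left_unit_idem])

lemma rop_right_unit:
  assumes "x \<in> P"
  shows "rop x (R x) = Some x"
  using assms by (simp add: rop_eq_Some_iff right_unit left_unit_eqI[OF right_unit_idem])

text \<open>Idempotence makes \<open>e\<close> its own left and right unit, so a restricted product
  of \<open>e\<close> with \<open>y\<close> can exist only if \<open>e\<close> is \<open>L y\<close>
  or \<open>R y\<close>, according to its side.\<close>

lemma two_sided_unit_rop:
  assumes "m e e = Some e"
  shows "two_sided_unit P rop e"
proof -
  have "e \<in> P" "L e = e" "R e = e"
    using operation_on[OF assms] left_unit_eqI[OF assms] right_unit_eqI[OF assms] by auto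
  moreover have "rop e y = Some y" if "y \<in> P" "rop e y \<noteq> None" for y
    using that \<open>R e = e\<close> rop_left_unit[of y] by (auto simp: rop_eq_Some_iff)
  moreover have "rop y e = Some y" if "y \<in> P" "rop y e \<noteq> None" for y
    using that \<open>L e = e\<close> rop_right_unit[of y] by (auto simp: rop_eq_Some_iff)
  ultimately show ?thesis
    by (simp add: two_sided_unit_def)
qed

lemma magmoid_rop: "magmoid P rop"
proof
  show "P \<noteq> {}"
    by (rule carrier_nonempty)
  show "x \<in> P \<and> y \<in> P \<and> z \<in> P" if "rop x y = Some z" for x y z
    using that operation_on by (auto simp: rop_eq_Some_iff)
  \<comment> \<open>Any element of \<open>P\<close> yields a defined product with its left
    unit.\<close>
  show "\<exists>x\<in>P. \<exists>y\<in>P. rop x y \<noteq> None"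
    using carrier_nonempty left_unit(1) rop_left_unit by blast
qed

lemma semigroupoid_rop: "semigroupoid P rop"
proof (intro semigroupoid.intro magmoid_rop semigroupoid_axioms.intro)
  fix x y z
  assume P: "x \<in> P" "y \<in> P" "z \<in> P"
    and defined: "prod_right rop x y z \<noteq> None \<or> prod_left rop x y z \<noteq> None \<or>
      (rop x y \<noteq> None \<and> rop y z \<noteq> None)"
  \<comment> \<open>In the compound cases the outer product matches a unit of \<open>xy\<close> or
    \<open>yz\<close>, which is replaced by \<open>R y\<close> or \<open>L y\<close>.\<close>
  have "R x = L y \<and> R y = L z"
    using defined
    by (auto simp: prod_left_def prod_right_def rop_eq_Some_iff bind_eq_Some_conv
        left_unit_prod right_unit_prod)
  then have eqs: "R x = L y" "R y = L z"
    by simp_all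
  obtain u where u: "m x y = Some u" "rop x y = Some u"
    using rop_defined P eqs by blast
  obtain v where v: "m y z = Some v" "rop y z = Some v"
    using rop_defined P eqs by blast
  obtain w where w: "m u z = Some w" "m x v = Some w"
    using assoc_of_factors[OF u(1) v(1)] by auto
  \<comment> \<open>The outer products match because \<open>R u = R y = L z\<close> and
    \<open>R x = L y = L v\<close>.\<close>
  have "rop u z = Some w" "rop x v = Some w"
    using eqs w left_unit_prod[OF v(1)] right_unit_prod[OF u(1)]
    by (simp_all add: rop_eq_Some_iff)
  with u v show "prod_right rop x y z \<noteq> None \<and> prod_right rop x y z = prod_left rop x y z"
    by (simp add: prod_left_def prod_right_def)
qed

lemma poloid_rop: "poloid P rop"
proof (intro poloid.intro semigroupoid_rop poloid_axioms.intro)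
  fix x
  assume "x \<in> P"
  \<comment> \<open>The witness is \<open>L x\<close>, a two-sided unit for \<open>rop\<close>
    because it is idempotent.\<close>
  then show "\<exists>l. left_effective_unit P rop x l"
    using two_sided_unit_rop[OF left_unit_idem] rop_left_unit
    by (auto simp: left_effective_unit_def)
next
  fix x
  assume "x \<in> P"
  then show "\<exists>r. right_effective_unit P rop x r"
    using two_sided_unit_rop[OF right_unit_idem] rop_right_unit
    by (auto simp: right_effective_unit_def)
qed

end

theorem theorem8p1:
  fixes P :: "'a set" and m :: "'a \<Rightarrow> 'a \<Rightarrow> 'a option"
  assumes "prepoloid P m" and "unique_local_units P m"
  shows "poloid P (restricted_op P m)"
  using assms
  by (intro unique_prepoloid.poloid_rop unique_prepoloid.intro unique_prepoloid_axioms.intro)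

end
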